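(* Let $0<p<1$, let $(a_n)_{n=1}^\infty$ and $(b_n)_{n=1}^\infty$ be sequences in $(0,\infty)$, and let $\phi\colon\mathbb{R}\to\mathbb{R}$ be Lipschitz with $\phi(0)=0$ and $\phi'(0)\neq0$ (in particular $\phi$ is differentiable at $0$). For $t\in\mathbb{R}$ consider the formal series $$F(t)=\sum_{n=1}^\infty a_n\,\phi(b_nt)\,e_n.$$ Suppose that $\lim_n b_n=\infty$. If $F$ is Lipschitz on $\mathbb{R}$ (as a map into $\ell_p$), then it is differentiable almost everywhere on $\mathbb{R}$. Moreover, $F$ is Lipschitz on $\mathbb{R}$ if and only if $$\sum_{n=1}^\infty(a_nb_n)^p<\infty.$$
   Context: $\ell_p$ is the space of scalar sequences $x=(x_n)_{n=1}^\infty$ with $\|x\|_p=(\sum_n|x_n|^p)^{1/p}<\infty$, and $(e_n)_{n=1}^\infty$ is its canonical basis. "$F$ is Lipschitz on $\mathbb{R}$" means that $F(t)=(a_n\phi(b_nt))_{n=1}^\infty\in\ell_p$ for all $t\in\mathbb{R}$ and there is $L<\infty$ with $\|F(t)-F(s)\|_p\le L|t-s|$ for all $s,t\in\mathbb{R}$. $F\colon\mathbb{R}\to\ell_p$ is differentiable at $s$ if there is $v\in\ell_p$ with $\lim_{t\to s}\left\|\frac{F(t)-F(s)}{t-s}-v\right\|_p=0$. "Almost everywhere" refers to Lebesgue measure. *)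

theory Defs
  imports "HOL-Analysis.Analysis"
begin

text \<open>
  For \<open>0 < p < 1\<close> the functional \<open>lp_norm p\<close> is only a quasi-norm. Sequences are indexed from 0,
  and sequences outside \<open>lp_space p\<close> have no meaningful \<open>lp_norm\<close>.
\<close>

definition lp_space :: "real \<Rightarrow> (nat \<Rightarrow> 'a::real_normed_vector) set" where
  "lp_space p = {x. summable (\<lambda>n. norm (x n) powr p)}"

definition lp_norm :: "real \<Rightarrow> (nat \<Rightarrow> 'a::real_normed_vector) \<Rightarrow> real" where
  "lp_norm p x = (\<Sum>n. norm (x n) powr p) powr (1 / p)"

definition lp_lipschitz :: "real \<Rightarrow> (real \<Rightarrow> nat \<Rightarrow> 'a::real_normed_vector) \<Rightarrow> bool" where
  "lp_lipschitz p F \<longleftrightarrow>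
     (\<forall>t. F t \<in> lp_space p) \<and>
     (\<exists>L. \<forall>s t. lp_norm p (\<lambda>n. F t n - F s n) \<le> L * \<bar>t - s\<bar>)"

definition lp_differentiable_at ::
    "real \<Rightarrow> (real \<Rightarrow> nat \<Rightarrow> 'a::real_normed_vector) \<Rightarrow> real \<Rightarrow> bool" where
  "lp_differentiable_at p F s \<longleftrightarrow>
     (\<forall>t. F t \<in> lp_space p) \<and>
     (\<exists>v\<in>lp_space p.
        ((\<lambda>t. lp_norm p (\<lambda>n. (F t n - F s n) /\<^sub>R (t - s) - v n)) \<longlongrightarrow> 0) (at s))"

end

theory Submission imports Defs begin

text \<open>
  For the equivalence, the quotients \<open>a\<^sub>n \<phi>(b\<^sub>n t) / t\<close> are bounded by a multiple of
  \<open>a\<^sub>n b\<^sub>n\<close> and tend to \<open>\<phi>'(0) a\<^sub>n b\<^sub>n\<close> as \<open>t \<rightarrow> 0\<close>. Differentiability of the vector-valued map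
  at a point follows by dominated convergence from that of all its coordinates, which holds almost
  everywhere because a Lipschitz function on the line is differentiable almost everywhere.

  For this last fact, adding a linear function makes the function expanding, hence a bi-Lipschitz
  homeomorphism \<open>g\<close>. By Vitali's covering theorem, \<open>g\<close> shrinks outer measure by the factor \<open>u\<close> on a
  set where some derivate is below \<open>u\<close>; applied to the inverse of \<open>g\<close>, this shows that outer measure
  grows by the factor \<open>v\<close> on a set where some derivate is above \<open>v\<close>. For \<open>u < v\<close> both can
  only happen on a null set.
\<close>

section \<open>Vitali covers and the distortion of outer measure\<close>

text \<open>Short intervals on which \<open>g\<close> has slope at most \<open>u\<close> form a
  Vitali cover of \<open>E\<close>. Countably many disjoint ones exhaust \<open>E\<close> up to a
  null set, which the Lipschitz map \<open>g\<close> sends to a null set. Measurable covers stand in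
  for outer measure, as \<open>E\<close> is arbitrary.\<close>

lemma monotone_image_cover:
  fixes g :: "real \<Rightarrow> real"
  assumes mono: "mono g" and Lip: "M-lipschitz_on UNIV g"
    and cover: "T \<in> lmeasurable" "E \<subseteq> T" "measure lebesgue T < B"
    and u: "u > 0"
    and E: "\<And>x d. \<lbrakk>x \<in> E; d > 0\<rbrakk> \<Longrightarrow>
      \<exists>l r. l \<le> x \<and> x \<le> r \<and> l < r \<and> r - l < d \<and> g r - g l \<le> u * (r - l)"
  obtains T' where "T' \<in> lmeasurable" "g ` E \<subseteq> T'" "measure lebesgue T' < u * B"
proof -
  \<comment> \<open>\<open>T\<close> is enlarged to an open set, still of measure below
    \<open>B\<close>, so that small intervals around points of \<open>E\<close> stay inside
    it.\<close>
  obtain U where "open U" "T \<subseteq> U" "U - T \<in> lmeasurable"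
    "emeasure lebesgue (U - T) < ennreal (B - measure lebesgue T)"
    using sets_lebesgue_outer_open[OF fmeasurableD[OF cover(1)], of "B - measure lebesgue T"]
      cover(3) by auto
  moreover from this have "U \<in> lmeasurable"
    using fmeasurable.Un[OF cover(1), of "U - T"] by (simp add: Un_absorb1)
  moreover have "measure lebesgue U = measure lebesgue (U - T) + measure lebesgue T"
    using \<open>U \<in> lmeasurable\<close> \<open>T \<subseteq> U\<close> cover(1) by (simp add: measurable_measure_Diff fmeasurableD)
  ultimately have U: "open U" "T \<subseteq> U" "U \<in> lmeasurable" "measure lebesgue U < B"
    using cover(3) by (auto simp: emeasure_eq_measure2 ennreal_less_iff)
  \<comment> \<open>Intervals are coded as pairs of end points; \<open>c\<close> and
    \<open>\<rho>\<close> are midpoint and half length, as the covering theorem speaks of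
    balls.\<close>
  define K where "K = {i. fst i < snd i \<and> {fst i..snd i} \<subseteq> U \<and>
    g (snd i) - g (fst i) \<le> u * (snd i - fst i)}"
  define c where "c = (\<lambda>i::real \<times> real. (fst i + snd i) / 2)"
  define \<rho> where "\<rho> = (\<lambda>i::real \<times> real. (snd i - fst i) / 2)"
  have cb: "cball (c i) (\<rho> i) = {fst i..snd i}" for i
    by (simp add: c_def \<rho>_def cball_eq_atLeastAtMost field_simps)
  obtain C where C: "countable C" "C \<subseteq> K"
    "pairwise (\<lambda>i j. disjnt (cball (c i) (\<rho> i)) (cball (c j) (\<rho> j))) C"
    "negligible (E - (\<Union>i\<in>C. cball (c i) (\<rho> i)))"
  proof (rule Vitali_covering_theorem_cballs[of K \<rho> E c])
    show "0 < \<rho> i" if "i \<in> K" for i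
      using that by (auto simp: K_def \<rho>_def)
    fix x d :: real assume x: "x \<in> E" and d: "0 < d"
    obtain e where e: "e > 0" "ball x e \<subseteq> U"
      using U cover(2) x by (meson openE subsetD)
    obtain l r where lr: "l \<le> x" "x \<le> r" "l < r" "r - l < min d e" "g r - g l \<le> u * (r - l)"
      using E[OF x, of "min d e"] d e(1) by auto
    have "{l..r} \<subseteq> ball x e"
      using lr by (auto simp: dist_real_def)
    then have "(l, r) \<in> K"
      using lr e(2) by (auto simp: K_def)
    then show "\<exists>i. i \<in> K \<and> x \<in> cball (c i) (\<rho> i) \<and> \<rho> i < d"
      using lr by (intro exI[of _ "(l, r)"]) (auto simp: cb, auto simp: \<rho>_def)
  qed
  define V where "V = (\<Union>i\<in>C. {g (fst i)..g (snd i)})"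
  define N where "N = g ` (E - (\<Union>i\<in>C. {fst i..snd i}))"
  have neg: "negligible N"
    unfolding N_def
  proof (rule negligible_locally_Lipschitz_image)
    show "negligible (E - (\<Union>i\<in>C. {fst i..snd i}))"
      using C(4) by (simp add: cb)
    show "\<exists>T B. open T \<and> x \<in> T \<and>
        (\<forall>y\<in>(E - (\<Union>i\<in>C. {fst i..snd i})) \<inter> T. norm (g y - g x) \<le> B * norm (y - x))" for x
      using lipschitz_onD[OF Lip]
      by (intro exI[of _ UNIV] exI[of _ M]) (auto simp: dist_norm)
  qed simp
  \<comment> \<open>A bound uniform over finite subfamilies passes to the countable union.
    Disjointness turns the sum of lengths back into the measure of a subset of
    \<open>U\<close>.\<close>
  have bound: "measure lebesgue (\<Union>i\<in>I. {g (fst i)..g (snd i)}) \<le> u * measure lebesgue U"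
    if I: "I \<subseteq> C" "finite I" for I
  proof -
    have K: "fst i < snd i" "g (snd i) - g (fst i) \<le> u * (snd i - fst i)" "{fst i..snd i} \<subseteq> U"
      if "i \<in> I" for i
    proof -
      have "i \<in> K" using that I(1) C(2) by blast
      then show "fst i < snd i" "g (snd i) - g (fst i) \<le> u * (snd i - fst i)" "{fst i..snd i} \<subseteq> U"
        unfolding K_def mem_Collect_eq by blast+
    qed
    have "measure lebesgue (\<Union>i\<in>I. {g (fst i)..g (snd i)})
        \<le> (\<Sum>i\<in>I. measure lebesgue {g (fst i)..g (snd i)})"
      using I by (intro measure_UNION_le) auto
    also have "\<dots> \<le> (\<Sum>i\<in>I. u * measure lebesgue {fst i..snd i})"
    proof (rule sum_mono)
      fix i assume i: "i \<in> I"
      have "g (fst i) \<le> g (snd i)" using K(1)[OF i] mono by (simp add: monoD)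
      then show "measure lebesgue {g (fst i)..g (snd i)} \<le> u * measure lebesgue {fst i..snd i}"
        using K[OF i] by simp
    qed
    also have "\<dots> = u * measure lebesgue (\<Union>i\<in>I. {fst i..snd i})"
      using I C(3) by (subst measure_UNION') (auto simp: sum_distrib_left cb elim: pairwise_mono)
    also have "\<dots> \<le> u * measure lebesgue U"
      using K(3) u I(2) U(3) by (intro mult_left_mono measure_mono_fmeasurable) auto
    finally show ?thesis .
  qed
  have V: "V \<in> lmeasurable" "measure lebesgue V \<le> u * measure lebesgue U"
    unfolding V_def
    by (rule fmeasurable_UN_bound[OF C(1) _ bound] measure_UN_bound[OF C(1) _ bound]; simp)+
  show thesis
  proof
    show "V \<union> N \<in> lmeasurable"
      using V(1) negligible_imp_measurable[OF neg] by (rule fmeasurable.Un)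
    have "g x \<in> V \<union> N" if "x \<in> E" for x
    proof (cases "x \<in> (\<Union>i\<in>C. {fst i..snd i})")
      case True
      then have "g x \<in> V" using mono by (auto simp: V_def mono_def)
      then show ?thesis by blast
    next
      case False
      then show ?thesis using that unfolding N_def by blast
    qed
    then show "g ` E \<subseteq> V \<union> N" by blast
    have "measure lebesgue (V \<union> N) \<le> measure lebesgue V + measure lebesgue N"
      using V neg by (intro measure_Un_le) (auto simp: negligible_imp_sets)
    also have "\<dots> \<le> u * measure lebesgue U"
      using V neg by (simp add: negligible_imp_measure0)
    also have "\<dots> < u * B"
      using U(4) u by simp
    finally show "measure lebesgue (V \<union> N) < u * B" .
  qed
qed

text \<open>Expansion of \<open>g\<close> becomes the 1-Lipschitz bound of its inverse, so that
  \<open>monotone_image_cover\<close> can be applied to \<open>g\<close> and to \<open>inv g\<close>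
  alike.\<close>

lemma bilipschitz_inverse:
  fixes g :: "real \<Rightarrow> real"
  assumes expand: "\<And>x y. x \<le> y \<Longrightarrow> y - x \<le> g y - g x" and Lip: "M-lipschitz_on UNIV g"
  shows "mono g" "bij g" "mono (inv g)" "1-lipschitz_on UNIV (inv g)"
proof -
  show m: "mono g"
    using expand by (fastforce intro!: monoI)
  have inj: "inj g"
    by (rule linorder_injI) (use expand in \<open>smt (verit)\<close>)
  have "surj g"
    unfolding surj_def
  proof
    fix w
    \<comment> \<open>By expansion \<open>g\<close> changes by at least \<open>k\<close> between 0
      and each of \<open>-k\<close> and \<open>k\<close>, so \<open>w\<close> lies between
      \<open>g (-k)\<close> and \<open>g k\<close>.\<close>
    define k where "k = \<bar>w - g 0\<bar>"
    have "continuous_on {-k..k} g"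
      using Lip by (intro lipschitz_on_continuous_on[of M] lipschitz_on_subset[OF Lip]) auto
    moreover have "g (-k) \<le> w" "w \<le> g k"
      using expand[of "-k" 0] expand[of 0 k] by (auto simp: k_def abs_if split: if_splits)
    ultimately show "\<exists>x. w = g x"
      using IVT'[of g "-k" w k] by (auto simp: k_def)
  qed
  then show b: "bij g"
    using inj by (simp add: bij_def)
  have g_inv: "g (inv g w) = w" for w
    using b by (simp add: bij_is_surj surj_f_inv_f)
  show mi: "mono (inv g)"
  proof (rule monoI)
    fix w z :: real assume "w \<le> z"
    then show "inv g w \<le> inv g z"
      using expand[of "inv g z" "inv g w"] by (simp add: g_inv) linarith
  qed
  show "1-lipschitz_on UNIV (inv g)"
  proof (rule lipschitz_onI)
    fix w z
    show "dist (inv g w) (inv g z) \<le> 1 * dist w z"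
      using expand[of "inv g z" "inv g w"] expand[of "inv g w" "inv g z"]
      by (cases "inv g z \<le> inv g w") (auto simp: g_inv dist_real_def)
  qed simp
qed

lemma negligible_derivate_gap:
  fixes g :: "real \<Rightarrow> real"
  assumes expand: "\<And>x y. x \<le> y \<Longrightarrow> y - x \<le> g y - g x" and Lip: "M-lipschitz_on UNIV g"
    and uv: "0 < u" "u < v" and "bounded E"
    and low: "\<And>x d. \<lbrakk>x \<in> E; d > 0\<rbrakk> \<Longrightarrow>
      \<exists>l r. l \<le> x \<and> x \<le> r \<and> l < r \<and> r - l < d \<and> g r - g l \<le> u * (r - l)"
    and high: "\<And>x d. \<lbrakk>x \<in> E; d > 0\<rbrakk> \<Longrightarrow>
      \<exists>l r. l \<le> x \<and> x \<le> r \<and> l < r \<and> r - l < d \<and> g r - g l \<ge> v * (r - l)"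
  shows "negligible E"
proof -
  note g = bilipschitz_inverse[OF expand Lip]
  have inv_g: "inv g (g x) = x" for x
    using g(2) by (simp add: bij_is_inj)
  have M: "M \<ge> 0" using Lip lipschitz_on_nonneg by blast
  \<comment> \<open>With the axes swapped, a chord of \<open>g\<close> of slope at least
    \<open>v\<close> becomes a chord of \<open>inv g\<close> of slope at most
    \<open>1 / v\<close>.\<close>
  have high': "\<exists>l r. l \<le> w \<and> w \<le> r \<and> l < r \<and> r - l < d \<and> inv g r - inv g l \<le> (1 / v) * (r - l)"
    if "w \<in> g ` E" "d > 0" for w d
  proof -
    obtain x where x: "x \<in> E" "w = g x" using \<open>w \<in> g ` E\<close> by blast
    \<comment> \<open>\<open>g\<close> stretches lengths by at most \<open>M\<close>, so the image
      interval is shorter than \<open>d\<close>; the added 1 keeps the divisor positive.\<close>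
    obtain l r where lr: "l \<le> x" "x \<le> r" "l < r" "r - l < d / (M + 1)" "g r - g l \<ge> v * (r - l)"
      using high[OF x(1), of "d / (M + 1)"] \<open>d > 0\<close> M by auto
    have "g r - g l \<le> M * (r - l)"
      using lipschitz_onD[OF Lip, of l r] lr by (auto simp: dist_real_def)
    also have "\<dots> \<le> (M + 1) * (r - l)" using lr M by (intro mult_right_mono) auto
    also have "\<dots> < d" using lr(4) M by (simp add: field_simps)
    finally have "g r - g l < d" .
    moreover have "g l < g r" using expand[of l r] lr by simp
    ultimately show ?thesis
      using lr uv g(1) x(2)
      by (intro exI[of _ "g l"] exI[of _ "g r"]) (auto simp: inv_g monoD field_simps)
  qed
  obtain a b where ab: "E \<subseteq> cbox a b"
    using \<open>bounded E\<close> bounded_subset_cbox_symmetric by blast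
  \<comment> \<open>The added 1 makes the starting bound strict, as
    \<open>monotone_image_cover\<close> requires.\<close>
  define B where "B = measure lebesgue (cbox a b) + 1"
  \<comment> \<open>Passing from \<open>E\<close> to \<open>g ` E\<close> and back improves a cover by the factor \<open>u / v\<close>.\<close>
  have "\<exists>T. T \<in> lmeasurable \<and> E \<subseteq> T \<and> measure lebesgue T < (u / v) ^ n * B" for n
  proof (induction n)
    case 0
    show ?case using ab by (intro exI[of _ "cbox a b"]) (auto simp: B_def)
  next
    case (Suc n)
    then obtain T where T: "T \<in> lmeasurable" "E \<subseteq> T" "measure lebesgue T < (u / v) ^ n * B"
      by blast
    obtain T1 where T1: "T1 \<in> lmeasurable" "g ` E \<subseteq> T1"
      "measure lebesgue T1 < u * ((u / v) ^ n * B)"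
      by (rule monotone_image_cover[OF g(1) Lip T uv(1) low])
    obtain T2 where T2: "T2 \<in> lmeasurable" "inv g ` g ` E \<subseteq> T2"
      "measure lebesgue T2 < (1 / v) * (u * ((u / v) ^ n * B))"
    proof (rule monotone_image_cover[OF g(3) g(4) T1 _ high'])
      show "0 < 1 / v" using uv by simp
    qed
    then show ?case
      by (intro exI[of _ T2]) (auto simp: image_image inv_g)
  qed
  then obtain T where T: "\<And>n. T n \<in> lmeasurable" "\<And>n. E \<subseteq> T n"
    "\<And>n. measure lebesgue (T n) < (u / v) ^ n * B" by metis
  have lim: "(\<lambda>n. (u / v) ^ n * B) \<longlonglongrightarrow> 0"
    using uv by (intro tendsto_mult_left_zero LIMSEQ_power_zero) auto
  show ?thesis
    unfolding negligible_outer
  proof (intro allI impI)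
    fix e :: real assume "e > 0"
    then obtain n where "(u / v) ^ n * B < e"
      using order_tendstoD(2)[OF lim] eventually_happens' sequentially_bot by blast
    then show "\<exists>T. E \<subseteq> T \<and> T \<in> lmeasurable \<and> measure lebesgue T < e"
      using T by (meson less_trans)
  qed
qed

section \<open>Almost everywhere differentiability of real Lipschitz functions\<close>

text \<open>Compactness of \<open>{A..B}\<close> gives a cluster point \<open>D\<close> of
  \<open>q\<close> along \<open>F\<close>. If \<open>q\<close> did not converge to \<open>D\<close>,
  two rationals strictly between \<open>D\<close> and the values staying away from it would
  contradict \<open>gap\<close>. Rationals keep the number of exceptional sets countable in the
  application.\<close>

lemma tendsto_if_no_rational_gap:
  fixes q :: "'a \<Rightarrow> real"
  assumes F: "F \<noteq> bot" and bound: "\<forall>\<^sub>F y in F. q y \<in> {A..B}"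
    and gap: "\<And>u v. \<lbrakk>u \<in> \<rat>; v \<in> \<rat>; u < v; \<exists>\<^sub>F y in F. q y < u\<rbrakk> \<Longrightarrow> \<forall>\<^sub>F y in F. q y \<le> v"
  obtains D where "(q \<longlongrightarrow> D) F"
proof -
  obtain D where D: "inf (nhds D) (filtermap q F) \<noteq> bot"
    using compact_Icc[of A B, unfolded compact_filter, rule_format, of "filtermap q F"] F bound
    by (auto simp: eventually_filtermap filtermap_bot_iff)
  have freq: "\<exists>\<^sub>F y in F. q y \<in> S" if "open S" "D \<in> S" for S
  proof (rule ccontr)
    assume "\<not> ?thesis"
    then have "\<forall>\<^sub>F z in filtermap q F. z \<notin> S"
      by (simp add: not_frequently eventually_filtermap)
    moreover have "\<forall>\<^sub>F z in nhds D. z \<in> S"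
      using that by (rule eventually_nhds_in_open)
    ultimately have "\<forall>\<^sub>F z in inf (nhds D) (filtermap q F). False"
      unfolding eventually_inf by blast
    then show False using D by (simp add: eventually_False)
  qed
  show thesis
  proof (rule that, rule order_tendstoI)
    fix a assume "D < a"
    obtain u where u: "u \<in> \<rat>" "D < u" "u < a" using Rats_dense_in_real[OF \<open>D < a\<close>] by blast
    obtain v where v: "v \<in> \<rat>" "u < v" "v < a" using Rats_dense_in_real[OF u(3)] by blast
    have "\<forall>\<^sub>F y in F. q y \<le> v"
      using gap[OF u(1) v(1,2)] freq[of "{..<u}"] u(2) by simp
    then show "\<forall>\<^sub>F y in F. q y < a" by eventually_elim (use v in simp)
  next
    fix a assume "a < D"
    obtain u where u: "u \<in> \<rat>" "a < u" "u < D" using Rats_dense_in_real[OF \<open>a < D\<close>] by blast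
    obtain v where v: "v \<in> \<rat>" "u < v" "v < D" using Rats_dense_in_real[OF u(3)] by blast
    have "\<not> (\<forall>\<^sub>F y in F. q y \<le> v)"
      using freq[of "{v<..}"] v(3) by (simp add: frequently_def not_less)
    \<comment> \<open>This is \<open>gap\<close> in contrapositive form: \<open>q \<le> v\<close>
      fails frequently, so \<open>q < u\<close> cannot hold frequently.\<close>
    then have "\<forall>\<^sub>F y in F. u \<le> q y"
      using gap[OF u(1) v(1,2)] not_frequently[of "\<lambda>y. q y < u" F] by (auto simp: not_less)
    then show "\<forall>\<^sub>F y in F. a < q y" by eventually_elim (use u in simp)
  qed
qed

lemma frequently_at_interval:
  fixes x :: real
  assumes "\<exists>\<^sub>F y in at x. P (min x y) (max x y)" "d > 0"
  shows "\<exists>l r. l \<le> x \<and> x \<le> r \<and> l < r \<and> r - l < d \<and> P l r"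
proof -
  obtain y where "y \<noteq> x" "dist y x < d" "P (min x y) (max x y)"
    using assms unfolding frequently_at by blast
  then show ?thesis
    by (intro exI[of _ "min x y"] exI[of _ "max x y"]) (auto simp: dist_real_def)
qed

text \<open>Difference quotients stay in \<open>{1..M}\<close>, so where they fail to converge they
  are frequently below some rational \<open>u\<close> and frequently above a larger rational
  \<open>v\<close>. Bounded pieces of these sets are null by \<open>negligible_derivate_gap\<close>,
  and there are countably many.\<close>

lemma bilipschitz_differentiable_ae:
  fixes g :: "real \<Rightarrow> real"
  assumes expand: "\<And>x y. x \<le> y \<Longrightarrow> y - x \<le> g y - g x" and Lip: "M-lipschitz_on UNIV g"
  shows "negligible {x. \<not> g differentiable at x}"
proof -
  define q where "q = (\<lambda>x y. (g y - g x) / (y - x))"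
  define G where "G = (\<lambda>u v. {x. (\<exists>\<^sub>F y in at x. q x y < u) \<and> (\<exists>\<^sub>F y in at x. v < q x y)})"
  \<comment> \<open>The quotient is symmetric in \<open>x\<close> and \<open>y\<close>, hence the
    slope of a chord over an interval with \<open>x\<close> as an end point.\<close>
  have q: "q x y = (g (max x y) - g (min x y)) / (max x y - min x y)" for x y
    by (cases "x \<le> y") (simp_all add: q_def max_def min_def field_simps minus_divide_right [symmetric])
  have q1: "1 \<le> q x y" "q x y \<le> M" if "y \<noteq> x" for x y
  proof -
    define l r where "l = min x y" and "r = max x y"
    have "l < r" using that by (auto simp: l_def r_def)
    then show "1 \<le> q x y" "q x y \<le> M"
      using expand[of l r] lipschitz_onD[OF Lip, of l r]
      unfolding q l_def[symmetric] r_def[symmetric] by (auto simp: dist_real_def field_simps)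
  qed
  have ev: "\<forall>\<^sub>F y in at x. y \<noteq> x" for x :: real
    by (simp add: eventually_at_filter)
  have neg: "negligible (G u v \<inter> cball 0 (real n))" if "0 < u" "u < v" for u v n
  proof (rule negligible_derivate_gap[OF expand Lip that])
    show "bounded (G u v \<inter> cball 0 (real n))" by (simp add: bounded_Int)
    fix x d :: real assume x: "x \<in> G u v \<inter> cball 0 (real n)" and d: "d > 0"
    have "\<exists>\<^sub>F y in at x. g (max x y) - g (min x y) \<le> u * (max x y - min x y)"
    proof (rule frequently_mp[OF eventually_mono[OF ev]])
      show "\<exists>\<^sub>F y in at x. q x y < u" using x by (simp add: G_def)
      show "q x y < u \<longrightarrow> g (max x y) - g (min x y) \<le> u * (max x y - min x y)"
        if "y \<noteq> x" for y
        using that unfolding q by (simp add: divide_less_eq)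
    qed
    then show "\<exists>l r. l \<le> x \<and> x \<le> r \<and> l < r \<and> r - l < d \<and> g r - g l \<le> u * (r - l)"
      using d by (rule frequently_at_interval)
    have "\<exists>\<^sub>F y in at x. g (max x y) - g (min x y) \<ge> v * (max x y - min x y)"
    proof (rule frequently_mp[OF eventually_mono[OF ev]])
      show "\<exists>\<^sub>F y in at x. v < q x y" using x by (simp add: G_def)
      show "v < q x y \<longrightarrow> g (max x y) - g (min x y) \<ge> v * (max x y - min x y)"
        if "y \<noteq> x" for y
        using that unfolding q by (simp add: less_divide_eq)
    qed
    then show "\<exists>l r. l \<le> x \<and> x \<le> r \<and> l < r \<and> r - l < d \<and> g r - g l \<ge> v * (r - l)"
      using d by (rule frequently_at_interval)
  qed
  define I where "I = {(u, v, n :: nat). u \<in> \<rat> \<and> v \<in> \<rat> \<and> 0 < u \<and> u < (v :: real)}"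
  have "countable (\<rat> \<times> \<rat> \<times> (UNIV :: nat set) :: (real \<times> real \<times> nat) set)"
    by (intro countable_SIGMA countable_rat) simp
  then have "countable I"
    by (rule countable_subset[rotated]) (auto simp: I_def)
  then have "negligible (\<Union>(u, v, n)\<in>I. G u v \<inter> cball 0 (real n))"
    using neg by (intro negligible_countable_Union) (auto simp: I_def)
  moreover have "{x. \<not> g differentiable at x} \<subseteq> (\<Union>(u, v, n)\<in>I. G u v \<inter> cball 0 (real n))"
  proof
    fix x assume "x \<in> {x. \<not> g differentiable at x}"
    then have nd: "\<nexists>D. (q x \<longlongrightarrow> D) (at x)"
      unfolding q_def by (auto simp: real_differentiable_def has_field_derivative_iff)
    obtain n where n: "\<bar>x\<bar> \<le> real n" using real_arch_simple by blast
    have "\<exists>u v. u \<in> \<rat> \<and> v \<in> \<rat> \<and> u < v \<and> (\<exists>\<^sub>F y in at x. q x y < u) \<and> \<not> (\<forall>\<^sub>F y in at x. q x y \<le> v)"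
    proof (rule ccontr)
      assume "\<not> ?thesis"
      then have gap: "\<forall>\<^sub>F y in at x. q x y \<le> v"
        if "u \<in> \<rat>" "v \<in> \<rat>" "u < v" "\<exists>\<^sub>F y in at x. q x y < u" for u v
        using that by blast
      have bound: "\<forall>\<^sub>F y in at x. q x y \<in> {1..M}"
        using ev by eventually_elim (simp add: q1)
      obtain D where "(q x \<longlongrightarrow> D) (at x)"
        by (rule tendsto_if_no_rational_gap[OF _ bound]) (simp, rule gap)
      then show False using nd by blast
    qed
    then obtain u v where uv: "u \<in> \<rat>" "v \<in> \<rat>" "u < v" "\<exists>\<^sub>F y in at x. q x y < u"
      "\<exists>\<^sub>F y in at x. v < q x y"
      by (auto simp: not_eventually not_le)
    \<comment> \<open>The gap sets are known to be null only for \<open>u > 0\<close>; a quotient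
      below \<open>u\<close> forces this, since all quotients are at least 1.\<close>
    have "\<exists>\<^sub>F y in at x. q x y < u \<and> y \<noteq> x"
      using uv(4) ev by (rule frequently_eventually_conj[THEN frequently_elim1]) auto
    then obtain y where "q x y < u" "y \<noteq> x"
      using frequently_ex by blast
    then have "0 < u" using q1(1)[of y x] by simp
    then show "x \<in> (\<Union>(u, v, n)\<in>I. G u v \<inter> cball 0 (real n))"
      using uv n by (auto simp: I_def G_def intro!: bexI[of _ "(u, v, n)"])
  qed
  ultimately show ?thesis by (rule negligible_subset)
qed

lemma lipschitz_differentiable_ae:
  fixes f :: "real \<Rightarrow> real"
  assumes "C-lipschitz_on UNIV f"
  shows "AE x in lebesgue. f differentiable at x"
proof -
  \<comment> \<open>For \<open>x \<le> y\<close> the function \<open>f\<close> drops by at most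
    \<open>C * (y - x)\<close>, so the added slope \<open>C + 1\<close> leaves a growth of at least
    \<open>y - x\<close>.\<close>
  define g where "g = (\<lambda>x. f x + (C + 1) * x)"
  have C: "C \<ge> 0" using assms lipschitz_on_nonneg by blast
  have f: "\<bar>f y - f x\<bar> \<le> C * \<bar>y - x\<bar>" for x y
    using lipschitz_onD[OF assms, of y x] by (simp add: dist_real_def)
  have expand: "y - x \<le> g y - g x" if "x \<le> y" for x y
    using f[of y x] that by (simp add: g_def abs_le_iff algebra_simps)
  have "(C + (C + 1))-lipschitz_on UNIV g"
    unfolding g_def using assms C
    by (intro lipschitz_on_add lipschitz_onI) (auto simp: dist_real_def abs_mult simp flip: right_diff_distrib intro: f)
  then have "negligible {x. \<not> g differentiable at x}"
    by (intro bilipschitz_differentiable_ae[OF expand])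
  moreover have "f differentiable at x" if "g differentiable at x" for x
  proof -
    have "(\<lambda>y. g y - (C + 1) * y) differentiable at x"
      using that by (intro derivative_intros)
    then show ?thesis by (simp add: g_def)
  qed
  ultimately have "{x. \<not> f differentiable at x} \<in> null_sets lebesgue"
    unfolding negligible_iff_null_sets[symmetric] by (blast intro: negligible_subset)
  then show ?thesis
    by (rule AE_I') auto
qed

section \<open>From real coordinates to maps into \<open>lp_space p\<close>\<close>

lemma lp_norm_of_real:
  "lp_norm p (\<lambda>n. of_real (x n) :: 'a::real_normed_algebra_1) = (\<Sum>n. \<bar>x n\<bar> powr p) powr (1 / p)"
  by (simp add: lp_norm_def)

lemma of_real_in_lp_space_iff:
  "(\<lambda>n. of_real (x n) :: 'a::real_normed_algebra_1) \<in> lp_space p \<longleftrightarrow> summable (\<lambda>n. \<bar>x n\<bar> powr p)"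
  by (simp add: lp_space_def)

text \<open>The coordinate estimates are raised to the power \<open>p\<close> and summed, giving the
  constant \<open>(\<Sum>n. c n powr p) powr (1 / p)\<close>. Summability at a single
  \<open>t\<close> is the case \<open>s = 0\<close>, as \<open>f n 0 = 0\<close>.\<close>

lemma lp_lipschitz_of_real:
  fixes f :: "nat \<Rightarrow> real \<Rightarrow> real"
  assumes p: "0 < p" and Lip: "\<And>n. (c n)-lipschitz_on UNIV (f n)" and zero: "\<And>n. f n 0 = 0"
    and c: "summable (\<lambda>n. c n powr p)"
  shows "lp_lipschitz p (\<lambda>t n. of_real (f n t) :: 'a::real_normed_algebra_1)"
proof -
  have c0: "c n \<ge> 0" for n using Lip lipschitz_on_nonneg by blast
  have le: "\<bar>f n t - f n s\<bar> powr p \<le> c n powr p * \<bar>t - s\<bar> powr p" for n t s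
  proof -
    have "\<bar>f n t - f n s\<bar> powr p \<le> (c n * \<bar>t - s\<bar>) powr p"
      using p lipschitz_onD[OF Lip, of t s n] by (intro powr_mono2) (auto simp: dist_real_def)
    then show ?thesis by (simp add: powr_mult c0)
  qed
  have sm: "summable (\<lambda>n. \<bar>f n t - f n s\<bar> powr p)" for t s
    by (rule summable_comparison_test'[OF summable_mult2[OF c, of "\<bar>t - s\<bar> powr p"], of 0])
      (simp add: le)
  have "lp_norm p (\<lambda>n. of_real (f n t) - of_real (f n s) :: 'a)
      \<le> (\<Sum>n. c n powr p) powr (1 / p) * \<bar>t - s\<bar>" for s t
  proof -
    have "(\<Sum>n. \<bar>f n t - f n s\<bar> powr p) \<le> (\<Sum>n. c n powr p) * \<bar>t - s\<bar> powr p"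
      using suminf_le[OF le sm summable_mult2[OF c]] suminf_mult2[OF c] by simp
    then have "(\<Sum>n. \<bar>f n t - f n s\<bar> powr p) powr (1 / p)
        \<le> ((\<Sum>n. c n powr p) * \<bar>t - s\<bar> powr p) powr (1 / p)"
      using p sm by (intro powr_mono2 suminf_nonneg) auto
    also have "\<dots> = (\<Sum>n. c n powr p) powr (1 / p) * \<bar>t - s\<bar>"
      using p c by (simp add: powr_mult suminf_nonneg powr_powr)
    finally show ?thesis by (simp add: lp_norm_of_real flip: of_real_diff)
  qed
  moreover have "summable (\<lambda>n. \<bar>f n t\<bar> powr p)" for t
    using sm[of t 0] by (simp add: zero)
  ultimately show ?thesis
    unfolding lp_lipschitz_def of_real_in_lp_space_iff by blast
qed

text \<open>The derivative is the sequence \<open>v\<close> of coordinate derivatives. Quotients and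
  their limits are bounded by \<open>c n\<close>, so the errors are dominated by
  \<open>2 * c n\<close>, and Tannery's theorem moves the limit inside the sum of
  \<open>p\<close>-th powers.\<close>

lemma lp_differentiable_at_of_real:
  fixes f :: "nat \<Rightarrow> real \<Rightarrow> real"
  assumes p: "0 < p" and Lip: "\<And>n. (c n)-lipschitz_on UNIV (f n)"
    and c: "summable (\<lambda>n. c n powr p)"
    and sm: "\<And>t. summable (\<lambda>n. \<bar>f n t\<bar> powr p)"
    and diff: "\<And>n. f n differentiable at s"
  shows "lp_differentiable_at p (\<lambda>t n. of_real (f n t) :: 'a::real_normed_algebra_1) s"
proof -
  have c0: "c n \<ge> 0" for n using Lip lipschitz_on_nonneg by blast
  define Q where "Q = (\<lambda>n t. (f n t - f n s) / (t - s))"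
  obtain v where v: "\<And>n. (Q n \<longlongrightarrow> v n) (at s)"
    using diff unfolding real_differentiable_def has_field_derivative_iff Q_def by metis
  \<comment> \<open>At \<open>t = s\<close> division by zero gives 0, so the bound holds for every
    \<open>t\<close>.\<close>
  have Q: "\<bar>Q n t\<bar> \<le> c n" for n t
    using lipschitz_onD[OF Lip, of t s n] c0[of n]
    by (cases "t = s") (auto simp: Q_def dist_real_def divide_le_eq)
  have v_le: "\<bar>v n\<bar> \<le> c n" for n
    using Q by (intro tendsto_upperbound[OF tendsto_rabs[OF v]]) auto
  have bound: "\<bar>Q n t - v n\<bar> powr p \<le> 2 powr p * c n powr p" for n t
  proof -
    have "\<bar>Q n t - v n\<bar> powr p \<le> (2 * c n) powr p"
      using p Q[of n t] v_le[of n] by (intro powr_mono2) auto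
    then show ?thesis by (simp add: powr_mult c0)
  qed
  have "((\<lambda>t. \<Sum>n. \<bar>Q n t - v n\<bar> powr p) \<longlongrightarrow> (\<Sum>n. 0)) (at s)"
  proof -
    have "((\<lambda>t. \<bar>Q n t - v n\<bar> powr p) \<longlongrightarrow> 0) (at s)" for n
      using p by (intro tendsto_zero_powrI tendsto_rabs_zero LIM_zero v tendsto_const) auto
    moreover have "\<forall>\<^sub>F (n, t) in at_top \<times>\<^sub>F at s. norm (\<bar>Q n t - v n\<bar> powr p) \<le> 2 powr p * c n powr p"
      by (rule always_eventually) (auto simp: bound)
    ultimately show ?thesis
      using tannerys_theorem[of "\<lambda>n t. \<bar>Q n t - v n\<bar> powr p" "\<lambda>_. 0" "at s"
          "\<lambda>n. 2 powr p * c n powr p"] c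
      by (auto intro: summable_mult)
  qed
  then have lim: "((\<lambda>t. (\<Sum>n. \<bar>Q n t - v n\<bar> powr p) powr (1 / p)) \<longlongrightarrow> 0) (at s)"
    using p bound c
    by (intro tendsto_zero_powrI[OF _ tendsto_const] always_eventually allI suminf_nonneg)
      (auto intro!: summable_comparison_test'[OF summable_mult[OF c, of "2 powr p"], of 0])
  have "(\<lambda>n. (of_real (f n t) - of_real (f n s)) /\<^sub>R (t - s) - of_real (v n) :: 'a)
      = (\<lambda>n. of_real (Q n t - v n))" for t
    by (simp add: Q_def scaleR_conv_of_real divide_inverse mult.commute)
  then have "((\<lambda>t. lp_norm p (\<lambda>n. (of_real (f n t) - of_real (f n s)) /\<^sub>R (t - s) - of_real (v n) :: 'a))
      \<longlongrightarrow> 0) (at s)"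
    using lim by (simp only: lp_norm_of_real)
  moreover have "summable (\<lambda>n. \<bar>v n\<bar> powr p)"
    by (rule summable_comparison_test'[OF c, of 0]) (use p v_le in \<open>auto intro: powr_mono2\<close>)
  ultimately show ?thesis
    unfolding lp_differentiable_at_def of_real_in_lp_space_iff using sm
    by (auto simp: of_real_in_lp_space_iff intro!: bexI[of _ "\<lambda>n. of_real (v n)"])
qed

text \<open>A Fatou argument: comparison with the value 0 at \<open>t = 0\<close> bounds all partial
  sums of \<open>\<bar>f n t / t\<bar> powr p\<close> by \<open>L powr p\<close>. In each finite sum
  \<open>t\<close> may tend to 0, and the bound does not depend on \<open>N\<close>.\<close>

lemma summable_derivative_of_lp_lipschitz:
  fixes f :: "nat \<Rightarrow> real \<Rightarrow> real"
  assumes p: "0 < p" and Lip: "lp_lipschitz p (\<lambda>t n. of_real (f n t) :: 'a::real_normed_algebra_1)"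
    and zero: "\<And>n. f n 0 = 0" and deriv: "\<And>n. (f n has_real_derivative f' n) (at 0)"
  shows "summable (\<lambda>n. \<bar>f' n\<bar> powr p)"
proof -
  have sm: "summable (\<lambda>n. \<bar>f n t\<bar> powr p)" for t
    using Lip by (simp add: lp_lipschitz_def of_real_in_lp_space_iff)
  obtain L where "lp_norm p (\<lambda>n. of_real (f n t) - of_real (f n 0) :: 'a) \<le> L * \<bar>t - 0\<bar>" for t
    using Lip unfolding lp_lipschitz_def by blast
  then have L: "(\<Sum>n. \<bar>f n t\<bar> powr p) powr (1 / p) \<le> L * \<bar>t\<bar>" for t
    by (simp add: zero lp_norm_of_real)
  have L0: "L \<ge> 0" using order_trans[OF powr_ge_zero L[of 1]] by simp
  have sum_le: "(\<Sum>n<N. \<bar>f n t / t\<bar> powr p) \<le> L powr p" if "t \<noteq> 0" for N t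
  proof -
    have "(\<Sum>n<N. \<bar>f n t\<bar> powr p) \<le> (\<Sum>n. \<bar>f n t\<bar> powr p)"
      by (intro sum_le_suminf sm) auto
    also have "\<dots> = ((\<Sum>n. \<bar>f n t\<bar> powr p) powr (1 / p)) powr p"
      using p by (simp add: powr_powr suminf_nonneg sm)
    also have "\<dots> \<le> (L * \<bar>t\<bar>) powr p"
      using p L by (intro powr_mono2) auto
    also have "\<dots> = L powr p * \<bar>t\<bar> powr p"
      using L0 by (simp add: powr_mult)
    finally have "(\<Sum>n<N. \<bar>f n t\<bar> powr p) / \<bar>t\<bar> powr p \<le> L powr p"
      using that by (simp add: divide_le_eq)
    then show ?thesis
      by (simp add: powr_divide sum_divide_distrib)
  qed
  have "(\<Sum>n<N. \<bar>f' n\<bar> powr p) \<le> L powr p" for N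
  proof (rule tendsto_upperbound)
    show "((\<lambda>t. \<Sum>n<N. \<bar>f n t / t\<bar> powr p) \<longlongrightarrow> (\<Sum>n<N. \<bar>f' n\<bar> powr p)) (at 0)"
      using deriv p by (intro tendsto_sum tendsto_powr2 tendsto_rabs tendsto_const)
        (auto simp: has_field_derivative_iff zero)
    show "\<forall>\<^sub>F t in at 0. (\<Sum>n<N. \<bar>f n t / t\<bar> powr p) \<le> L powr p"
      using sum_le by (intro eventually_at_filter[THEN iffD2] always_eventually) blast
  qed simp
  \<comment> \<open>The summability criterion uses sums over \<open>{..n}\<close>, which are the
    sums over \<open>{..<Suc n}\<close> just bounded.\<close>
  then show ?thesis
    by (intro bounded_imp_summable[of _ "L powr p"])
      (simp_all only: powr_ge_zero flip: lessThan_Suc_atMost)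
qed

section \<open>Coordinates that are scaled copies of \<open>\<phi>\<close>\<close>

theorem theorem6p1:
  fixes p :: real
    and a b :: "nat \<Rightarrow> real"
    and \<phi> :: "real \<Rightarrow> real"
    and F :: "real \<Rightarrow> nat \<Rightarrow> 'a::real_normed_field"
  assumes "0 < p" and "p < 1"
    and "\<And>n. a n > 0" and "\<And>n. b n > 0"
    and "\<exists>C. C-lipschitz_on UNIV \<phi>"
    and "\<phi> 0 = 0"
    and "\<exists>d. d \<noteq> 0 \<and> (\<phi> has_real_derivative d) (at 0)"
    and "\<And>t n. F t n = of_real (a n * \<phi> (b n * t))"
    and "filterlim b at_top sequentially"
  shows "(lp_lipschitz p F \<longrightarrow> (AE t in lebesgue. lp_differentiable_at p F t)) \<and>
         (lp_lipschitz p F \<longleftrightarrow> summable (\<lambda>n. (a n * b n) powr p))"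
proof -
  obtain C where C: "C-lipschitz_on UNIV \<phi>" using assms(5) by blast
  obtain d where d: "d \<noteq> 0" "(\<phi> has_real_derivative d) (at 0)" using assms(7) by blast
  have C0: "C \<ge> 0" using C lipschitz_on_nonneg by blast
  define f where "f = (\<lambda>n t. a n * \<phi> (b n * t))"
  define c where "c = (\<lambda>n. C * (a n * b n))"
  have F: "F = (\<lambda>t n. of_real (f n t))"
    using assms(8) by (simp add: fun_eq_iff f_def)
  have pos: "0 < a n * b n" for n using assms(3,4) by simp
  have Lip: "(c n)-lipschitz_on UNIV (f n)" for n
  proof (rule lipschitz_onI)
    fix x y :: real
    have "dist (f n x) (f n y) = a n * dist (\<phi> (b n * x)) (\<phi> (b n * y))"
      using assms(3)[of n] by (simp add: f_def dist_real_def abs_mult flip: right_diff_distrib)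
    also have "\<dots> \<le> a n * (C * dist (b n * x) (b n * y))"
      using assms(3)[of n] by (intro mult_left_mono lipschitz_onD[OF C]) auto
    also have "\<dots> = c n * dist x y"
      using assms(4)[of n] by (simp add: c_def dist_real_def abs_mult flip: right_diff_distrib)
    finally show "dist (f n x) (f n y) \<le> c n * dist x y" .
  qed (use pos C0 in \<open>simp add: c_def less_imp_le\<close>)
  have zero: "f n 0 = 0" for n using assms(6) by (simp add: f_def)
  have deriv: "(f n has_real_derivative d * (a n * b n)) (at 0)" for n
  proof -
    have "(\<phi> has_real_derivative d) (at (b n * 0))" using d(2) by simp
    then show ?thesis
      unfolding f_def by (auto intro!: derivative_eq_intros DERIV_chain2[of \<phi>])
  qed
  \<comment> \<open>A nonzero factor does not affect summability; for \<open>k = d\<close> this is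
    where the nonvanishing derivative of \<open>\<phi>\<close> at 0 enters.\<close>
  have summable_scale: "summable (\<lambda>n. \<bar>k * (a n * b n)\<bar> powr p) \<longleftrightarrow> summable (\<lambda>n. (a n * b n) powr p)"
    if "k \<noteq> 0" for k
    using that pos by (simp add: abs_mult[of k] powr_mult less_imp_le abs_of_pos)
  have sm_c: "summable (\<lambda>n. c n powr p)" if "summable (\<lambda>n. (a n * b n) powr p)"
    using that pos C0 by (auto simp: c_def powr_mult[of C] less_imp_le intro!: summable_mult)
  have iff: "lp_lipschitz p F \<longleftrightarrow> summable (\<lambda>n. (a n * b n) powr p)"
  proof
    assume "lp_lipschitz p F"
    then have "summable (\<lambda>n. \<bar>d * (a n * b n)\<bar> powr p)"
      unfolding F by (rule summable_derivative_of_lp_lipschitz[OF assms(1) _ zero deriv])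
    then show "summable (\<lambda>n. (a n * b n) powr p)"
      using summable_scale[OF d(1)] by blast
  next
    assume "summable (\<lambda>n. (a n * b n) powr p)"
    then show "lp_lipschitz p F"
      unfolding F by (intro lp_lipschitz_of_real[OF assms(1) Lip zero] sm_c)
  qed
  moreover have "AE t in lebesgue. lp_differentiable_at p F t" if "lp_lipschitz p F"
  proof -
    have "summable (\<lambda>n. \<bar>f n t\<bar> powr p)" for t
      using that by (simp add: F lp_lipschitz_def of_real_in_lp_space_iff)
    then have "lp_differentiable_at p F t" if "\<forall>n. f n differentiable at t" for t
      unfolding F using that \<open>lp_lipschitz p F\<close> iff
      by (intro lp_differentiable_at_of_real[OF assms(1) Lip sm_c]) auto
    \<comment> \<open>Each coordinate has a null exceptional set, and countably many null sets have
      a null union.\<close>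
    moreover have "AE t in lebesgue. \<forall>n. f n differentiable at t"
      using lipschitz_differentiable_ae[OF Lip] by (simp add: AE_all_countable)
    ultimately show ?thesis by (auto elim: eventually_mono)
  qed
  ultimately show ?thesis by blast
qed

end
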